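(* There is an absolute constant $c>0$ such that the following holds. Let $k$ be a positive integer and let $d \geq 4$ be an integer. Then there exists a set $P$ of points in $\mathbb{R}^d$ such that, letting $\mathcal{R}$ denote the set system induced on $P$ by half-spaces of $\mathbb{R}^d$, we have $$\operatorname{vcdim}\left(\mathcal{R}^{k\cup}\right) \geq c \cdot \operatorname{vcdim}(\mathcal{R}) \cdot k \log k \quad\text{and}\quad \operatorname{vcdim}\left(\mathcal{R}^{k\cup}\right) \geq c\cdot d \cdot k \log k,$$ and likewise $$\operatorname{vcdim}\left(\mathcal{R}^{k\cap}\right) \geq c \cdot \operatorname{vcdim}(\mathcal{R}) \cdot k \log k \quad\text{and}\quad \operatorname{vcdim}\left(\mathcal{R}^{k\cap}\right) \geq c\cdot d \cdot k \log k.$$ (In the paper's notation: $\operatorname{vcdim}(\mathcal{R}^{k\cup}) = \Omega(\operatorname{vcdim}(\mathcal{R})\cdot k\log k) = \Omega(d\cdot k\log k)$, and the same for $\mathcal{R}^{k\cap}$.)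
   Context: A set system $(X,\mathcal{R})$ consists of a set $X$ and a family $\mathcal{R}$ of subsets of $X$. The set system induced on $P \subseteq \mathbb{R}^d$ by half-spaces is $\mathcal{R} = \{P \cap H : H \text{ a (closed or open) half-space of } \mathbb{R}^d\}$. For an integer $k \geq 1$, the $k$-fold union is $\mathcal{R}^{k\cup} = \{R_1 \cup \cdots \cup R_k : R_1,\dots,R_k \in \mathcal{R}\}$ (the $R_i$ need not be distinct), and the $k$-fold intersection is $\mathcal{R}^{k\cap} = \{R_1 \cap \cdots \cap R_k : R_1,\dots,R_k \in \mathcal{R}\}$ (the $R_i$ need not be distinct). For $Y \subseteq X$, $\mathcal{R}$ shatters $Y$ if $\{Y \cap R : R \in \mathcal{R}\}$ is the full power set of $Y$; $\operatorname{vcdim}(\mathcal{R})$ is the largest size of a subset of $X$ shattered by $\mathcal{R}$. Logarithms are base 2. *)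

theory Defs
  imports Complex_Main "HOL-Library.Extended_Real"
begin

definition euclid :: "nat \<Rightarrow> (nat \<Rightarrow> real) set" where
  "euclid d = {x. \<forall>i\<ge>d. x i = 0}"

definition halfspaces :: "nat \<Rightarrow> (nat \<Rightarrow> real) set set" where
  "halfspaces d =
     {{x \<in> euclid d. (\<Sum>i<d. a i * x i) \<le> b} | a b. \<exists>i<d. a i \<noteq> 0} \<union>
     {{x \<in> euclid d. (\<Sum>i<d. a i * x i) < b} | a b. \<exists>i<d. a i \<noteq> 0}"

definition halfspace_system :: "nat \<Rightarrow> (nat \<Rightarrow> real) set \<Rightarrow> (nat \<Rightarrow> real) set set" where
  "halfspace_system d P = {P \<inter> H | H. H \<in> halfspaces d}"

definition k_union :: "nat \<Rightarrow> 'a set set \<Rightarrow> 'a set set" where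
  "k_union k R = {(\<Union>i<k. f i) | f. \<forall>i<k. f i \<in> R}"

definition k_inter :: "nat \<Rightarrow> 'a set set \<Rightarrow> 'a set set" where
  "k_inter k R = {(\<Inter>i<k. f i) | f. \<forall>i<k. f i \<in> R}"

definition shatters :: "'a set set \<Rightarrow> 'a set \<Rightarrow> bool" where
  "shatters R Y \<longleftrightarrow> {Y \<inter> r | r. r \<in> R} = Pow Y"

definition vcdim :: "'a set \<Rightarrow> 'a set set \<Rightarrow> enat" where
  "vcdim X R = Sup {enat (card Y) | Y. Y \<subseteq> X \<and> finite Y \<and> shatters R Y}"

end

theory Submission
  imports Defs
begin

text \<open>
  Take for \<open>P\<close> the whole space. Radon's argument bounds the VC-dimension of half-spaces by \<open>d + 1\<close>,
  and complementation exchanges unions and intersections, so it suffices to find about \<open>d k log k\<close>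
  points that are shattered by unions of \<open>k\<close> half-spaces.

  Dyadic subdivision yields \<open>N 2^(N-1)\<close> axis-parallel rectangles in the plane such that every
  subfamily consists of exactly those rectangles that are hit by suitable \<open>2^N\<close> points.
  With \<open>M > 4\<close>, an integer point \<open>(a, b)\<close> lies in the integer rectangle \<open>[x1, x2] \<times> [y1, y2]\<close> iff
  \<open>M^(a-x2) + M^(x1-a) + M^(b-y2) + M^(y1-b) \<le> 4\<close>, so that rectangles become points and points become
  half-spaces of 4-space. Finally, \<open>d div 4\<close> copies of this configuration are placed
  in orthogonal 4-dimensional coordinate subspaces, where one half-space with a fixed right-hand
  side acts independently on each copy.
\<close>

section \<open>Upper bound for half-spaces\<close>

text \<open>Gaussian elimination, one equation and one unknown at a time. It supplies the affine
  dependence needed for Radon's argument.\<close>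

lemma homogeneous_system_nontrivial_solution:
  fixes A :: "'a \<Rightarrow> nat \<Rightarrow> real"
  assumes "finite Y" "card Y > n"
  shows "\<exists>l. (\<exists>y\<in>Y. l y \<noteq> 0) \<and> (\<forall>i<n. (\<Sum>y\<in>Y. l y * A y i) = 0)"
  using assms
proof (induction n arbitrary: Y A)
  case 0
  then have "\<exists>y. y \<in> Y" by (metis card.empty less_nat_zero_code ex_in_conv)
  then show ?case by (intro exI[of _ "\<lambda>_. 1"]) auto
next
  case (Suc n)
  show ?case
  proof (cases "\<forall>y\<in>Y. A y n = 0")
    case True
    from Suc.IH[of Y A] Suc.prems obtain l where
      l: "\<exists>y\<in>Y. l y \<noteq> 0" "\<forall>i<n. (\<Sum>y\<in>Y. l y * A y i) = 0" by auto
    have "(\<Sum>y\<in>Y. l y * A y n) = 0" using True by simp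
    with l show ?thesis by (auto simp: less_Suc_eq)
  next
    case False
    then obtain z where z: "z \<in> Y" "A z n \<noteq> 0" by auto
    \<comment> \<open>\<open>B\<close> is the system left after solving equation \<open>n\<close>
      for the weight of the pivot \<open>z\<close> and substituting; \<open>l'\<close> below
      restores that weight.\<close>
    define B where "B y i = A y i - A y n / A z n * A z i" for y i
    have "card (Y - {z}) > n" using Suc.prems z by simp
    with Suc.IH[of "Y - {z}" B] Suc.prems obtain l where
      l: "\<exists>y\<in>Y-{z}. l y \<noteq> 0" "\<forall>i<n. (\<Sum>y\<in>Y-{z}. l y * B y i) = 0" by auto
    define S where "S = (\<Sum>y\<in>Y-{z}. l y * A y n)"
    define l' where "l' = l(z := - S / A z n)"
    have split: "(\<Sum>y\<in>Y. l' y * A y i) = - S / A z n * A z i + (\<Sum>y\<in>Y-{z}. l y * A y i)" for i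
    proof -
      have "(\<Sum>y\<in>Y. l' y * A y i) = l' z * A z i + (\<Sum>y\<in>Y-{z}. l' y * A y i)"
        using Suc.prems(1) z(1) by (rule sum.remove)
      also have "(\<Sum>y\<in>Y-{z}. l' y * A y i) = (\<Sum>y\<in>Y-{z}. l y * A y i)"
        by (intro sum.cong) (auto simp: l'_def)
      finally show ?thesis by (simp add: l'_def)
    qed
    have "(\<Sum>y\<in>Y. l' y * A y i) = 0" if "i < Suc n" for i
    proof (cases "i = n")
      case True
      then show ?thesis using z unfolding split by (simp add: S_def)
    next
      case False
      with that have "i < n" by simp
      with l(2) have "0 = (\<Sum>y\<in>Y-{z}. l y * B y i)" by simp
      also have "\<dots> = (\<Sum>y\<in>Y-{z}. l y * A y i - (l y * A y n) * (A z i / A z n))"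
        by (intro sum.cong) (auto simp: B_def algebra_simps)
      also have "\<dots> = (\<Sum>y\<in>Y-{z}. l y * A y i) - S * (A z i / A z n)"
        by (simp only: sum_subtractf S_def sum_distrib_right)
      finally show ?thesis unfolding split by simp
    qed
    moreover have "\<exists>y\<in>Y. l' y \<noteq> 0" using l(1) by (auto simp: l'_def)
    ultimately show ?thesis by blast
  qed
qed

lemma halfspacesI:
  assumes "\<exists>i<d. a i \<noteq> 0"
  shows "{x \<in> euclid d. (\<Sum>i<d. a i * x i) \<le> b} \<in> halfspaces d"
    and "{x \<in> euclid d. (\<Sum>i<d. a i * x i) < b} \<in> halfspaces d"
  unfolding halfspaces_def Un_iff mem_Collect_eq using assms by metis+

lemma halfspaces_cases:
  assumes "H \<in> halfspaces d"
  obtains a b where "\<exists>i<d. a i \<noteq> 0" "H = {x \<in> euclid d. (\<Sum>i<d. a i * x i) \<le> b}"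
  | a b where "\<exists>i<d. a i \<noteq> 0" "H = {x \<in> euclid d. (\<Sum>i<d. a i * x i) < b}"
proof -
  from assms have "(\<exists>a b. H = {x \<in> euclid d. (\<Sum>i<d. a i * x i) \<le> b} \<and> (\<exists>i<d. a i \<noteq> 0)) \<or>
      (\<exists>a b. H = {x \<in> euclid d. (\<Sum>i<d. a i * x i) < b} \<and> (\<exists>i<d. a i \<noteq> 0))"
    unfolding halfspaces_def Un_iff mem_Collect_eq .
  then show thesis
  proof (elim disjE)
    assume "\<exists>a b. H = {x \<in> euclid d. (\<Sum>i<d. a i * x i) \<le> b} \<and> (\<exists>i<d. a i \<noteq> 0)"
    then show thesis by - (elim exE, erule conjE, rule that(1))
  next
    assume "\<exists>a b. H = {x \<in> euclid d. (\<Sum>i<d. a i * x i) < b} \<and> (\<exists>i<d. a i \<noteq> 0)"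
    then show thesis by - (elim exE, erule conjE, rule that(2))
  qed
qed

text \<open>More than \<open>d + 1\<close> points carry a nontrivial affine dependence
  \<open>l\<close>, so the \<open>l\<close>-weighted sum of any affine function over
  \<open>Y\<close> vanishes. If a half-space cut out exactly the points of positive weight, all
  terms of this sum would be nonpositive and one negative.\<close>

lemma card_shattered_by_halfspaces_le:
  assumes Y: "finite Y" "Y \<subseteq> euclid d" and sh: "shatters (halfspaces d) Y"
  shows "card Y \<le> d + 1"
proof (rule ccontr)
  assume "\<not> card Y \<le> d + 1"
  then have "card Y > Suc d" by simp
  \<comment> \<open>The extra column \<open>d\<close> is constantly 1, so its equation says that the
    weights sum to 0.\<close>
  from homogeneous_system_nontrivial_solution[OF Y(1) this, of "\<lambda>y i. if i = d then 1 else y i"]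
  obtain l where l: "\<exists>y\<in>Y. l y \<noteq> 0"
    "\<forall>i<Suc d. (\<Sum>y\<in>Y. l y * (if i = d then 1 else y i)) = 0" by blast
  have sum0: "(\<Sum>y\<in>Y. l y) = 0" using l(2)[rule_format, of d] by simp
  have coord0: "(\<Sum>y\<in>Y. l y * y i) = 0" if "i < d" for i
    using l(2)[rule_format, of i] that by simp
  have balance: "(\<Sum>y\<in>Y. l y * ((\<Sum>i<d. a i * y i) - b)) = 0" for a b
  proof -
    have "(\<Sum>y\<in>Y. l y * (\<Sum>i<d. a i * y i)) = (\<Sum>y\<in>Y. \<Sum>i<d. a i * (l y * y i))"
      by (simp add: sum_distrib_left mult.left_commute)
    also have "\<dots> = (\<Sum>i<d. a i * (\<Sum>y\<in>Y. l y * y i))"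
      by (subst sum.swap) (simp add: sum_distrib_left)
    also have "\<dots> = 0" using coord0 by simp
    finally have "(\<Sum>y\<in>Y. l y * (\<Sum>i<d. a i * y i)) = 0" .
    moreover have "(\<Sum>y\<in>Y. l y * b) = 0" using sum0 by (simp flip: sum_distrib_right)
    ultimately show ?thesis by (simp add: right_diff_distrib sum_subtractf)
  qed
  have pos: "\<exists>y\<in>Y. l y > 0"
  proof (rule ccontr)
    assume "\<not> ?thesis"
    then have "\<And>y. y \<in> Y \<Longrightarrow> l y \<le> 0" by (simp add: not_less)
    then have "\<forall>y\<in>Y. - l y = 0"
      using sum0 by (subst sum_nonneg_eq_0_iff[OF Y(1), symmetric]) (auto simp: sum_negf)
    with l(1) show False by simp
  qed
  have neg: "\<exists>y\<in>Y. l y < 0"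
  proof (rule ccontr)
    assume "\<not> ?thesis"
    then have "\<And>y. y \<in> Y \<Longrightarrow> l y \<ge> 0" by (simp add: not_less)
    then have "\<forall>y\<in>Y. l y = 0"
      using sum0 by (subst sum_nonneg_eq_0_iff[OF Y(1), symmetric]) auto
    with l(1) show False by simp
  qed
  have "{y \<in> Y. l y > 0} \<in> {Y \<inter> r | r. r \<in> halfspaces d}"
    using sh unfolding shatters_def by blast
  then obtain H where H: "H \<in> halfspaces d" "{y \<in> Y. l y > 0} = Y \<inter> H" by auto
  have absurd: False
    if le: "\<And>y. y \<in> Y \<Longrightarrow> l y * ((\<Sum>i<d. a i * y i) - b) \<le> 0"
      and less: "\<exists>y\<in>Y. l y * ((\<Sum>i<d. a i * y i) - b) < 0" for a b
  proof -
    have "(\<Sum>y\<in>Y. l y * ((\<Sum>i<d. a i * y i) - b)) < (\<Sum>y\<in>Y. 0)"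
      using le less Y(1) by (intro sum_strict_mono_ex1) auto
    with balance show False by simp
  qed
  from H(1) show False
  proof (cases rule: halfspaces_cases)
    case (1 a b)
    have iff: "l y > 0 \<longleftrightarrow> (\<Sum>i<d. a i * y i) \<le> b" if "y \<in> Y" for y
      using that H(2) Y(2) 1(2) by (auto simp: set_eq_iff)
    show False
    proof (rule absurd)
      fix y assume "y \<in> Y"
      then show "l y * ((\<Sum>i<d. a i * y i) - b) \<le> 0"
        using iff[of y] by (auto simp: mult_le_0_iff)
    next
      \<comment> \<open>Points of positive weight may lie on the boundary of a closed half-space, so
        the strict term must come from a negative weight. For an open half-space a positive weight
        provides it.\<close>
      from neg obtain y where "y \<in> Y" "l y < 0" by blast
      then show "\<exists>y\<in>Y. l y * ((\<Sum>i<d. a i * y i) - b) < 0"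
        using iff[of y] by (intro bexI[of _ y]) (auto simp: mult_less_0_iff)
    qed
  next
    case (2 a b)
    have iff: "l y > 0 \<longleftrightarrow> (\<Sum>i<d. a i * y i) < b" if "y \<in> Y" for y
      using that H(2) Y(2) 2(2) by (auto simp: set_eq_iff)
    show False
    proof (rule absurd)
      fix y assume "y \<in> Y"
      then show "l y * ((\<Sum>i<d. a i * y i) - b) \<le> 0"
        using iff[of y] by (auto simp: mult_le_0_iff)
    next
      from pos obtain y where "y \<in> Y" "l y > 0" by blast
      then show "\<exists>y\<in>Y. l y * ((\<Sum>i<d. a i * y i) - b) < 0"
        using iff[of y] by (intro bexI[of _ y]) (auto simp: mult_less_0_iff)
    qed
  qed
qed

lemma halfspace_system_euclid: "halfspace_system d (euclid d) = halfspaces d"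
proof -
  have "euclid d \<inter> H = H" if "H \<in> halfspaces d" for H
    using that unfolding halfspaces_def by blast
  then show ?thesis unfolding halfspace_system_def by force
qed

lemma vcdim_halfspaces_le: "vcdim (euclid d) (halfspaces d) \<le> enat (d + 1)"
  unfolding vcdim_def
proof (rule Sup_least)
  fix n assume "n \<in> {enat (card Y) | Y. Y \<subseteq> euclid d \<and> finite Y \<and> shatters (halfspaces d) Y}"
  then obtain Y where "n = enat (card Y)" "Y \<subseteq> euclid d" "finite Y" "shatters (halfspaces d) Y"
    by auto
  then show "n \<le> enat (d + 1)" using card_shattered_by_halfspaces_le[of Y d] by simp
qed

section \<open>Exchanging unions and intersections\<close>

lemma halfspaces_Compl:
  assumes "H \<in> halfspaces d"
  shows "euclid d - H \<in> halfspaces d"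
  using assms
proof (cases rule: halfspaces_cases)
  case (1 a b)
  have "euclid d - H = {x \<in> euclid d. (\<Sum>i<d. (- a i) * x i) < - b}"
    by (auto simp: 1(2) sum_negf)
  moreover have "\<exists>i<d. - a i \<noteq> 0" using 1(1) by simp
  ultimately show ?thesis using halfspacesI(2)[of d "\<lambda>i. - a i"] by simp
next
  case (2 a b)
  have "euclid d - H = {x \<in> euclid d. (\<Sum>i<d. (- a i) * x i) \<le> - b}"
    by (auto simp: 2(2) sum_negf)
  moreover have "\<exists>i<d. - a i \<noteq> 0" using 2(1) by simp
  ultimately show ?thesis using halfspacesI(1)[of d "\<lambda>i. - a i"] by simp
qed

lemma shatters_iff: "shatters R Y \<longleftrightarrow> (\<forall>Z\<subseteq>Y. \<exists>r\<in>R. Y \<inter> r = Z)"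
proof -
  have "{Y \<inter> r | r. r \<in> R} \<subseteq> Pow Y" by auto
  then have "shatters R Y \<longleftrightarrow> Pow Y \<subseteq> {Y \<inter> r | r. r \<in> R}" unfolding shatters_def by auto
  also have "\<dots> \<longleftrightarrow> (\<forall>Z\<subseteq>Y. \<exists>r\<in>R. Y \<inter> r = Z)"
    unfolding subset_eq[of "Pow Y"] Ball_def Pow_iff mem_Collect_eq Bex_def by metis
  finally show ?thesis .
qed

text \<open>De Morgan: complementing, relative to \<open>X\<close>, the members of a union that cuts
  out \<open>Y - Z\<close> gives an intersection that cuts out \<open>Z\<close>.\<close>

lemma shatters_k_inter_if_shatters_k_union:
  assumes "\<And>r. r \<in> R \<Longrightarrow> X - r \<in> R" "Y \<subseteq> X" "shatters (k_union k R) Y"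
  shows "shatters (k_inter k R) Y"
  unfolding shatters_iff
proof (intro allI impI)
  fix Z assume Z: "Z \<subseteq> Y"
  have "Y - Z \<subseteq> Y" by blast
  with assms(3) obtain r where r: "r \<in> k_union k R" "Y \<inter> r = Y - Z"
    unfolding shatters_iff by meson
  then obtain f where f: "\<forall>i<k. f i \<in> R" "r = (\<Union>i<k. f i)"
    unfolding k_union_def by blast
  have "Y \<inter> (\<Inter>i<k. X - f i) = Y - Y \<inter> (\<Union>i<k. f i)" using assms(2) by auto
  also have "\<dots> = Z" using r(2) f(2) Z by auto
  finally have "Y \<inter> (\<Inter>i<k. X - f i) = Z" .
  moreover have "(\<Inter>i<k. X - f i) \<in> k_inter k R"
    unfolding k_inter_def using f(1) assms(1) by (intro CollectI exI[of _ "\<lambda>i. X - f i"]) simp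
  ultimately show "\<exists>r\<in>k_inter k R. Y \<inter> r = Z" by (rule bexI)
qed

section \<open>Rectangles\<close>

fun in_rect :: "nat \<times> nat \<Rightarrow> nat \<times> nat \<times> nat \<times> nat \<Rightarrow> bool" where
  "in_rect (a, b) (x1, x2, y1, y2) \<longleftrightarrow> x1 \<le> a \<and> a \<le> x2 \<and> y1 \<le> b \<and> b \<le> y2"

text \<open>
  \<open>dyadic_rects (Suc N)\<close> contains two copies of \<open>dyadic_rects N\<close>, one in the left and one in the right
  half of the square, each stretched vertically by the factor 2; the \<open>2 ^ N\<close> new rectangles
  are the even rows of the left half.
\<close>

fun dyadic_rects :: "nat \<Rightarrow> (nat \<times> nat \<times> nat \<times> nat) set" where
  "dyadic_rects 0 = {}"
| "dyadic_rects (Suc N) =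
     (\<lambda>v. (0, 2 ^ N - 1, 2 * v, 2 * v)) ` {..<2 ^ N} \<union>
     (\<lambda>(x1, x2, y1, y2). (x1, x2, 2 * y1, 2 * y2 + 1)) ` dyadic_rects N \<union>
     (\<lambda>(x1, x2, y1, y2). (2 ^ N + x1, 2 ^ N + x2, 2 * y1, 2 * y2 + 1)) ` dyadic_rects N"

lemma finite_dyadic_rects: "finite (dyadic_rects N)"
  by (induction N) auto

text \<open>Separates the halves: left copies stay in columns below \<open>2 ^ N\<close>, so they
  differ from right copies and are missed by points in the right half.\<close>

lemma dyadic_rects_bound:
  "(x1, x2, y1, y2) \<in> dyadic_rects N \<Longrightarrow> x1 < 2 ^ N \<and> x2 < 2 ^ N"
proof (induction N arbitrary: x1 x2 y1 y2)
  case (Suc N)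
  from Suc.prems show ?case
    by (auto dest!: Suc.IH intro: le_less_trans[OF diff_le_self])
qed simp

lemma card_dyadic_rects: "2 * card (dyadic_rects N) = N * 2 ^ N"
proof (induction N)
  case (Suc N)
  let ?A = "(\<lambda>v::nat. (0::nat, 2 ^ N - 1::nat, 2 * v, 2 * v)) ` {..<2 ^ N}"
  let ?B = "(\<lambda>(x1, x2, y1, y2). (x1, x2, 2 * y1, 2 * y2 + 1)) ` dyadic_rects N"
  let ?C = "(\<lambda>(x1, x2, y1, y2). (2 ^ N + x1, 2 ^ N + x2, 2 * y1, 2 * y2 + 1)) ` dyadic_rects N"
  have "card ?A = 2 ^ N" by (subst card_image) (auto simp: inj_on_def)
  moreover have "card ?B = card (dyadic_rects N)" by (intro card_image) (auto simp: inj_on_def)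
  moreover have "card ?C = card (dyadic_rects N)" by (intro card_image) (auto simp: inj_on_def)
  \<comment> \<open>The last coordinate is even for the new rectangles and odd for the stretched
    ones.\<close>
  moreover have "?A \<inter> ?B = {}" "?A \<inter> ?C = {}" by (auto, presburger+)
  moreover have "?B \<inter> ?C = {}" by (auto dest!: dyadic_rects_bound)
  ultimately have "card (dyadic_rects (Suc N)) = 2 ^ N + 2 * card (dyadic_rects N)"
    using finite_dyadic_rects[of N]
    by (simp add: card_Un_disjoint Int_Un_distrib2)
  with Suc show ?case by simp
qed simp

text \<open>
  In the induction step the two rows \<open>2 * v\<close> and \<open>2 * v + 1\<close> carry one point in each half of the square;
  whether the even row takes the left or the right half is free, and decides whether
  the new rectangle in row \<open>2 * v\<close> is hit.
\<close>

lemma dyadic_rects_hit_exactly: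
  "\<exists>f. (\<forall>y<2 ^ N. f y < 2 ^ N) \<and>
     (\<forall>r\<in>dyadic_rects N. r \<in> T \<longleftrightarrow> (\<exists>y<2 ^ N. in_rect (f y, y) r))"
proof (induction N arbitrary: T)
  case 0
  show ?case by (intro exI[of _ id]) auto
next
  case (Suc N)
  let ?l = "\<lambda>(x1, x2, y1, y2). (x1, x2, 2 * y1, 2 * y2 + 1)"
  let ?r = "\<lambda>(x1, x2, y1, y2). (2 ^ N + x1, 2 ^ N + x2, 2 * y1, 2 * y2 + 1)"
  let ?n = "\<lambda>v. (0::nat, 2 ^ N - 1::nat, 2 * v, 2 * v)"
  \<comment> \<open>The two copies prescribe independent subfamilies, obtained by pulling
    \<open>T\<close> back along each embedding.\<close>
  obtain f where f: "\<forall>y<2 ^ N. f y < 2 ^ N"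
    "\<forall>r\<in>dyadic_rects N. r \<in> ?l -` T \<longleftrightarrow> (\<exists>y<2 ^ N. in_rect (f y, y) r)"
    using Suc.IH by blast
  obtain g where g: "\<forall>y<2 ^ N. g y < 2 ^ N"
    "\<forall>r\<in>dyadic_rects N. r \<in> ?r -` T \<longleftrightarrow> (\<exists>y<2 ^ N. in_rect (g y, y) r)"
    using Suc.IH by blast
  define left where "left y \<longleftrightarrow> (even y \<longleftrightarrow> ?n (y div 2) \<in> T)" for y
  define h where "h y = (if left y then f (y div 2) else 2 ^ N + g (y div 2))" for y
  have half: "y div 2 < 2 ^ N" if "y < 2 ^ Suc N" for y :: nat
    using that by auto
  have two: "\<exists>y<2 ^ Suc N. y div 2 = v \<and> left y = c" if "v < 2 ^ N" for v c
  proof (cases "(?n v \<in> T) = c")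
    case True
    then show ?thesis using that by (intro exI[of _ "2 * v"]) (auto simp: left_def)
  next
    case False
    then show ?thesis using that by (intro exI[of _ "2 * v + 1"]) (auto simp: left_def)
  qed
  have "h y < 2 ^ Suc N" if "y < 2 ^ Suc N" for y
    using f(1) g(1) half[OF that] by (auto simp: h_def trans_less_add1)
  moreover have "r \<in> T \<longleftrightarrow> (\<exists>y<2 ^ Suc N. in_rect (h y, y) r)"
    if "r \<in> dyadic_rects (Suc N)" for r
  proof -
    from that consider v where "v < 2 ^ N" "r = ?n v"
      | q where "q \<in> dyadic_rects N" "r = ?l q"
      | q where "q \<in> dyadic_rects N" "r = ?r q"
      by auto
    then show ?thesis
    proof cases
      case 1
      have "in_rect (h y, y) r \<longleftrightarrow> y = 2 * v \<and> r \<in> T" if "y < 2 ^ Suc N" for y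
      proof -
        have "in_rect (h y, y) r \<longleftrightarrow> y = 2 * v \<and> h y < 2 ^ N"
          by (auto simp: 1 less_eq_Suc_le[symmetric] Suc_le_eq)
            (metis Suc_pred less_Suc_eq_le pos2 zero_less_power)+
        also have "\<dots> \<longleftrightarrow> y = 2 * v \<and> left y"
          using f(1) half[OF that] by (auto simp: h_def)
        finally show ?thesis by (auto simp: left_def 1)
      qed
      moreover have "2 * v < 2 ^ Suc N" using 1 by simp
      ultimately show ?thesis by blast
    next
      case 2
      obtain x1 x2 y1 y2 where q: "q = (x1, x2, y1, y2)" by (cases q)
      have x: "x2 < 2 ^ N" using 2 q dyadic_rects_bound by blast
      \<comment> \<open>A stretched rectangle contains both rows of a pair or neither in its
        vertical range, so only \<open>y div 2\<close> matters. By \<open>two\<close>, every pair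
        has a row in the required half.\<close>
      have "in_rect (h y, y) r \<longleftrightarrow> left y \<and> in_rect (f (y div 2), y div 2) q" for y
        using x by (auto simp: 2 q h_def)
      then have "(\<exists>y<2 ^ Suc N. in_rect (h y, y) r) \<longleftrightarrow> (\<exists>v<2 ^ N. in_rect (f v, v) q)"
        using two half by metis
      with f(2) 2 show ?thesis by auto
    next
      case 3
      obtain x1 x2 y1 y2 where q: "q = (x1, x2, y1, y2)" by (cases q)
      have "in_rect (h y, y) r \<longleftrightarrow> \<not> left y \<and> in_rect (g (y div 2), y div 2) q"
        if "y < 2 ^ Suc N" for y
        using f(1) half[OF that] by (auto simp: 3 q h_def)
      then have "(\<exists>y<2 ^ Suc N. in_rect (h y, y) r) \<longleftrightarrow> (\<exists>v<2 ^ N. in_rect (g v, v) q)"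
        using two half by metis
      with g(2) 3 show ?thesis by auto
    qed
  qed
  ultimately show ?case by blast
qed

section \<open>From rectangles to half-spaces\<close>

text \<open>Coordinates for base \<open>M = 5\<close>: each product with the matching coordinate of
  \<open>point_vec\<close> is a power of 5 whose exponent is nonpositive iff one of the four
  rectangle inequalities holds.\<close>

fun rect_vec :: "nat \<times> nat \<times> nat \<times> nat \<Rightarrow> nat \<Rightarrow> real" where
  "rect_vec (x1, x2, y1, y2) i =
     (if i = 0 then 1 / 5 ^ x2 else if i = 1 then 5 ^ x1 else if i = 2 then 1 / 5 ^ y2 else 5 ^ y1)"

fun point_vec :: "nat \<times> nat \<Rightarrow> nat \<Rightarrow> real" where
  "point_vec (a, b) i =
     (if i = 0 then 5 ^ a else if i = 1 then 1 / 5 ^ a else if i = 2 then 5 ^ b else 1 / 5 ^ b)"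

lemma power5_ratio:
  fixes a x :: nat
  shows "a \<le> x \<Longrightarrow> (5::real) ^ a / 5 ^ x \<le> 1" "\<not> a \<le> x \<Longrightarrow> (5::real) ^ a / 5 ^ x \<ge> 5"
proof -
  assume "\<not> a \<le> x"
  then have "(5::real) ^ Suc x \<le> 5 ^ a" by (intro power_increasing) auto
  then show "(5::real) ^ a / 5 ^ x \<ge> 5" by (simp add: field_simps)
qed (simp add: field_simps)

text \<open>Four satisfied inequalities give four terms of at most 1. By integrality a single
  violated one gives a term of at least 5, which the other, nonnegative terms cannot offset.\<close>

lemma in_rect_iff_halfspace: "in_rect p r \<longleftrightarrow> (\<Sum>i<4. point_vec p i * rect_vec r i) \<le> 4"
proof -
  obtain a b where p: "p = (a, b)" by (cases p)
  obtain x1 x2 y1 y2 where r: "r = (x1, x2, y1, y2)" by (cases r)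
  have sum: "(\<Sum>i<4. point_vec p i * rect_vec r i) =
      5 ^ a / 5 ^ x2 + 5 ^ x1 / 5 ^ a + 5 ^ b / 5 ^ y2 + 5 ^ y1 / 5 ^ b"
    by (simp add: p r eval_nat_numeral)
  have nonneg: "0 \<le> (5::real) ^ s / 5 ^ t" for s t :: nat by simp
  show ?thesis
  proof
    assume "in_rect p r"
    then have "x1 \<le> a" "a \<le> x2" "y1 \<le> b" "b \<le> y2" by (simp_all add: p r)
    then show "(\<Sum>i<4. point_vec p i * rect_vec r i) \<le> 4"
      unfolding sum using power5_ratio(1)[of a x2] power5_ratio(1)[of x1 a]
        power5_ratio(1)[of b y2] power5_ratio(1)[of y1 b] by linarith
  next
    assume "(\<Sum>i<4. point_vec p i * rect_vec r i) \<le> 4"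
    then have "x1 \<le> a \<and> a \<le> x2 \<and> y1 \<le> b \<and> b \<le> y2"
      unfolding sum using power5_ratio(2)[of a x2] power5_ratio(2)[of x1 a]
        power5_ratio(2)[of b y2] power5_ratio(2)[of y1 b]
        nonneg[of a x2] nonneg[of x1 a] nonneg[of b y2] nonneg[of y1 b]
      by linarith
    then show "in_rect p r" by (simp add: p r)
  qed
qed

lemma rect_vec_inject:
  assumes "\<And>i. i < 4 \<Longrightarrow> rect_vec r i = rect_vec r' i"
  shows "r = r'"
proof -
  obtain x1 x2 y1 y2 where r: "r = (x1, x2, y1, y2)" by (cases r)
  obtain x1' x2' y1' y2' where r': "r' = (x1', x2', y1', y2')" by (cases r')
  show ?thesis using assms[of 0] assms[of 1] assms[of 2] assms[of 3] by (simp add: r r')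
qed

section \<open>Copies in orthogonal 4-dimensional blocks, and the resulting bounds\<close>

definition block_vec :: "nat \<Rightarrow> (nat \<Rightarrow> real) \<Rightarrow> nat \<Rightarrow> real" where
  "block_vec j w i = (if i div 4 = j then w (i mod 4) else 0)"

lemma sum_mult_block_vec:
  assumes "4 * j + 4 \<le> d"
  shows "(\<Sum>i<d. a i * block_vec j w i) = (\<Sum>l<4. a (4 * j + l) * w l)"
proof -
  have "(\<Sum>i<d. a i * block_vec j w i) = (\<Sum>i\<in>(\<lambda>l. 4 * j + l) ` {..<4}. a i * block_vec j w i)"
  proof (rule sum.mono_neutral_right)
    show "\<forall>i\<in>{..<d} - (\<lambda>l. 4 * j + l) ` {..<4}. a i * block_vec j w i = 0"
    proof
      fix i assume i: "i \<in> {..<d} - (\<lambda>l. 4 * j + l) ` {..<4}"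
      have "i div 4 \<noteq> j"
      proof
        assume "i div 4 = j"
        then have "i = 4 * j + i mod 4" by auto
        with i show False by force
      qed
      then show "a i * block_vec j w i = 0" by (simp add: block_vec_def)
    qed
  qed (use assms in auto)
  also have "\<dots> = (\<Sum>l<4. a (4 * j + l) * w l)"
    by (subst sum.reindex) (auto simp: inj_on_def block_vec_def)
  finally show ?thesis .
qed

text \<open>The entries of \<open>rect_vec\<close> are positive, so the support reveals the block.
  Hence the number of points is multiplied by the number of copies.\<close>

lemma block_vec_rect_vec_inject:
  assumes "block_vec j (rect_vec r) = block_vec j' (rect_vec r')"
  shows "j = j' \<and> r = r'"
proof -
  have pos: "rect_vec r l > 0" for l by (cases r) auto
  have eq: "block_vec j (rect_vec r) (4 * j + l) = block_vec j' (rect_vec r') (4 * j + l)" for l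
    using assms by simp
  have "j = j'" using eq[of 0] pos[of 0] by (auto simp: block_vec_def split: if_splits)
  moreover have "rect_vec r l = rect_vec r' l" if "l < 4" for l
    using eq[of l] that \<open>j = j'\<close> by (simp add: block_vec_def)
  ultimately show ?thesis using rect_vec_inject by blast
qed

text \<open>The normal vector for row \<open>y\<close> concatenates, over all blocks
  \<open>j\<close>, the vectors of the points chosen in row \<open>y\<close> for copy
  \<open>j\<close>. A point of block \<open>j\<close> sees only its own part, and the right-hand
  side is always 4, so the same half-spaces serve all copies.\<close>

lemma ex_shattered_by_k_union:
  assumes N: "2 ^ N \<le> k" and m: "4 * m \<le> d" "m \<ge> 1"
  shows "\<exists>Y \<subseteq> euclid d. finite Y \<and> card Y = m * card (dyadic_rects N) \<and>
           shatters (k_union k (halfspaces d)) Y"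
proof -
  define e where "e = (\<lambda>(j, r). block_vec j (rect_vec r))"
  define I where "I = {..<m} \<times> dyadic_rects N"
  have inj: "inj_on e I"
    by (auto simp: inj_on_def e_def dest: block_vec_rect_vec_inject)
  have euclid: "e ` I \<subseteq> euclid d"
  proof -
    have "block_vec j w i = 0" if "j < m" "i \<ge> d" for j w i
      using that m by (auto simp: block_vec_def)
    then show ?thesis by (auto simp: e_def I_def euclid_def)
  qed
  have "\<exists>h\<in>k_union k (halfspaces d). e ` I \<inter> h = Z" if Z: "Z \<subseteq> e ` I" for Z
  proof -
    have "\<forall>j. \<exists>f. \<forall>r\<in>dyadic_rects N. e (j, r) \<in> Z \<longleftrightarrow> (\<exists>y<2 ^ N. in_rect (f y, y) r)"
    proof
      fix j
      show "\<exists>f. \<forall>r\<in>dyadic_rects N. e (j, r) \<in> Z \<longleftrightarrow> (\<exists>y<2 ^ N. in_rect (f y, y) r)"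
        using dyadic_rects_hit_exactly[of N "{r. e (j, r) \<in> Z}"] by auto
    qed
    then obtain f where f: "\<And>j r. r \<in> dyadic_rects N \<Longrightarrow>
        e (j, r) \<in> Z \<longleftrightarrow> (\<exists>y<2 ^ N. in_rect (f j y, y) r)"
      by metis
    define a where "a y i = point_vec (f (i div 4) y, y) (i mod 4)" for y i :: nat
    \<comment> \<open>Exactly \<open>k\<close> half-spaces are needed, so the \<open>2 ^ N\<close>
      useful ones are repeated cyclically.\<close>
    define h where "h t = {x \<in> euclid d. (\<Sum>i<d. a (t mod 2 ^ N) i * x i) \<le> 4}" for t
    have h: "h t \<in> halfspaces d" for t
    proof -
      have "0 < d" "a (t mod 2 ^ N) 0 \<noteq> 0" using m by (auto simp: a_def)
      then show ?thesis unfolding h_def by (intro halfspacesI) blast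
    qed
    have mem: "e (j, r) \<in> h t \<longleftrightarrow> in_rect (f j (t mod 2 ^ N), t mod 2 ^ N) r"
      if "(j, r) \<in> I" for j r t
    proof -
      have j: "4 * j + 4 \<le> d" using that m by (auto simp: I_def)
      have "e (j, r) \<in> euclid d" using euclid that by blast
      moreover have "(\<Sum>i<d. a y i * e (j, r) i) = (\<Sum>l<4. point_vec (f j y, y) l * rect_vec r l)" for y
        using sum_mult_block_vec[OF j, of "a y" "rect_vec r"] by (simp add: e_def a_def)
      ultimately show ?thesis by (simp add: h_def in_rect_iff_halfspace)
    qed
    have "e (j, r) \<in> (\<Union>t<k. h t) \<longleftrightarrow> e (j, r) \<in> Z" if "(j, r) \<in> I" for j r
    proof -
      have "e (j, r) \<in> (\<Union>t<k. h t) \<longleftrightarrow> (\<exists>t<k. in_rect (f j (t mod 2 ^ N), t mod 2 ^ N) r)"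
        using mem[OF that] by auto
      also have "\<dots> \<longleftrightarrow> (\<exists>y<2 ^ N. in_rect (f j y, y) r)"
      proof
        assume "\<exists>t<k. in_rect (f j (t mod 2 ^ N), t mod 2 ^ N) r"
        then show "\<exists>y<2 ^ N. in_rect (f j y, y) r"
          by (meson mod_less_divisor pos2 zero_less_power)
      next
        assume "\<exists>y<2 ^ N. in_rect (f j y, y) r"
        then show "\<exists>t<k. in_rect (f j (t mod 2 ^ N), t mod 2 ^ N) r"
          using N by (metis mod_less order_less_le_trans)
      qed
      finally show ?thesis using f that by (simp add: I_def)
    qed
    then have "x \<in> (\<Union>t<k. h t) \<longleftrightarrow> x \<in> Z" if "x \<in> e ` I" for x
      using that by (metis imageE prod.exhaust)
    then have "e ` I \<inter> (\<Union>t<k. h t) = Z" using Z by (intro set_eqI) (metis IntE IntI subsetD)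
    moreover have "(\<Union>t<k. h t) \<in> k_union k (halfspaces d)"
      unfolding k_union_def using h by (intro CollectI exI[of _ h]) simp
    ultimately show ?thesis by (rule bexI)
  qed
  then have "shatters (k_union k (halfspaces d)) (e ` I)"
    unfolding shatters_iff by blast
  moreover have "finite (e ` I)" by (simp add: I_def finite_dyadic_rects)
  moreover have "card (e ` I) = m * card (dyadic_rects N)"
    using inj by (simp add: card_image) (simp add: I_def card_cartesian_product)
  ultimately show ?thesis using euclid by blast
qed

text \<open>With \<open>N\<close> the integer part of \<open>log 2 k\<close>, the constant is 56 = 7
  * 4 * 2: 7 from rounding \<open>d\<close> down to a multiple of 4 (worst at \<open>d = 7\<close>),
  4 from rounding \<open>k\<close> and its logarithm, and 2 from
  \<open>card_dyadic_rects\<close>.\<close>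

lemma ex_large_shattered_by_k_union:
  assumes k: "k \<ge> 1" and d: "d \<ge> 4"
  shows "\<exists>Y \<subseteq> euclid d. finite Y \<and> shatters (k_union k (halfspaces d)) Y \<and>
           real d * real k * log 2 (real k) \<le> 56 * real (card Y)"
proof -
  obtain N where N: "2 ^ N \<le> k" "k < 2 ^ (N + 1)"
    using ex_power_ivl1[of 2 k] k by auto
  define m where "m = d div 4"
  have m: "4 * m \<le> d" "m \<ge> 1" "d \<le> 7 * m" using d unfolding m_def by presburger+
  obtain Y where Y: "Y \<subseteq> euclid d" "finite Y" "card Y = m * card (dyadic_rects N)"
    "shatters (k_union k (halfspaces d)) Y"
    using ex_shattered_by_k_union[OF N(1) m(1,2)] by blast
  have card: "2 * real (card Y) = real m * (real N * 2 ^ N)"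
    using arg_cong[OF card_dyadic_rects[of N], of real] Y(3) by simp
  have "real k * log 2 (real k) \<le> 4 * (real N * 2 ^ N)"
  \<comment> \<open>The estimate \<open>N + 1 \<le> 2 * N\<close> fails for \<open>N = 0\<close>,
    but then \<open>k = 1\<close> and the logarithm vanishes.\<close>
  proof (cases "N = 0")
    case True
    with N(2) k have "k = 1" by simp
    then show ?thesis by simp
  next
    case False
    have kr: "real k < 2 ^ (N + 1)" using N(2) by (metis of_nat_less_iff of_nat_numeral of_nat_power)
    have "log 2 (real k) < log 2 (2 ^ (N + 1))" using kr k by (subst log_less_cancel_iff) auto
    also have "\<dots> = real N + 1" by (subst log_nat_power) auto
    finally have "log 2 (real k) \<le> 2 * real N" using False by simp
    moreover have "real k \<le> 2 * 2 ^ N" using kr by simp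
    ultimately have "real k * log 2 (real k) \<le> (2 * 2 ^ N) * (2 * real N)"
      using k by (intro mult_mono) auto
    then show ?thesis by (simp add: algebra_simps)
  qed
  moreover have "real d \<le> 7 * real m" using m(3) by linarith
  moreover have "0 \<le> real k * log 2 (real k)" using k by simp
  ultimately have "real d * (real k * log 2 (real k)) \<le> (7 * real m) * (4 * (real N * 2 ^ N))"
    by (intro mult_mono[where b = "7 * real m"]) simp_all
  also have "\<dots> = 56 * real (card Y)" using card by (simp add: algebra_simps)
  finally show ?thesis using Y by (auto simp: mult.assoc)
qed

lemma card_le_vcdim:
  assumes "Y \<subseteq> X" "finite Y" "shatters R Y"
  shows "enat (card Y) \<le> vcdim X R"
  unfolding vcdim_def using assms by (intro Sup_upper) blast

theorem theorem1:
  shows "\<exists>c::real. c > 0 \<and>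
    (\<forall>k d::nat. k \<ge> 1 \<longrightarrow> d \<ge> 4 \<longrightarrow>
      (\<exists>P \<subseteq> euclid d.
         let R = halfspace_system d P in
         ereal_of_enat (vcdim P (k_union k R))
            \<ge> ereal c * ereal_of_enat (vcdim P R) * ereal (real k * log 2 (real k)) \<and>
         ereal_of_enat (vcdim P (k_union k R))
            \<ge> ereal (c * real d * real k * log 2 (real k)) \<and>
         ereal_of_enat (vcdim P (k_inter k R))
            \<ge> ereal c * ereal_of_enat (vcdim P R) * ereal (real k * log 2 (real k)) \<and>
         ereal_of_enat (vcdim P (k_inter k R))
            \<ge> ereal (c * real d * real k * log 2 (real k))))"
proof -
  \<comment> \<open>The constant is 112 = 2 * 56, where the factor 2 absorbs
    \<open>d + 1 \<le> 2 * d\<close> in the upper bound on the VC-dimension of half-spaces. That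
    bound also makes this dimension finite, which reduces the claims to real inequalities.\<close>
  have main: "ereal (1/112) * ereal_of_enat (vcdim (euclid d) R) * ereal (real k * log 2 (real k))
        \<le> ereal_of_enat v \<and>
      ereal (1/112 * real d * real k * log 2 (real k)) \<le> ereal_of_enat v"
    if k: "k \<ge> 1" and d: "d \<ge> 4" and R: "R = halfspaces d"
      and v: "v \<in> {vcdim (euclid d) (k_union k R), vcdim (euclid d) (k_inter k R)}" for k d R v
  proof -
    define L where "L = real k * log 2 (real k)"
    have L: "L \<ge> 0" using k by (simp add: L_def)
    obtain Y where Y: "Y \<subseteq> euclid d" "finite Y" "shatters (k_union k R) Y"
      "real d * L \<le> 56 * real (card Y)"
      using ex_large_shattered_by_k_union[OF k d] unfolding R L_def by (auto simp: mult.assoc)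
    have "shatters (k_inter k R) Y"
      using shatters_k_inter_if_shatters_k_union[OF _ Y(1,3)] halfspaces_Compl R by blast
    with Y(1-3) v have "enat (card Y) \<le> v" using card_le_vcdim by blast
    then have v: "ereal (real (card Y)) \<le> ereal_of_enat v"
      by (metis ereal_of_enat_le_iff ereal_of_enat_simps(1))
    obtain n where n: "vcdim (euclid d) R = enat n" "n \<le> d + 1"
      using vcdim_halfspaces_le[of d] R by (metis enat_ord_simps(1) enat_ile)
    have "1/112 * real n * L \<le> 1/112 * (2 * real d) * L"
      using n(2) d L by (intro mult_mono) auto
    with Y(4) have "1/112 * real n * L \<le> real (card Y)" by linarith
    moreover have "1/112 * real d * L \<le> real (card Y)"
      using Y(4) by simp
    ultimately have "ereal (1/112 * real n * L) \<le> ereal_of_enat v"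
      "ereal (1/112 * real d * L) \<le> ereal_of_enat v"
      using v by (meson ereal_less_eq(3) order_trans)+
    then show ?thesis by (simp add: n(1) L_def mult.assoc)
  qed
  show ?thesis
  proof (intro exI[of _ "1/112"] conjI allI impI)
    fix k d :: nat
    assume "k \<ge> 1" "d \<ge> 4"
    note main[OF this halfspace_system_euclid]
    then show "\<exists>P\<subseteq>euclid d.
         let R = halfspace_system d P in
         ereal_of_enat (vcdim P (k_union k R))
            \<ge> ereal (1/112) * ereal_of_enat (vcdim P R) * ereal (real k * log 2 (real k)) \<and>
         ereal_of_enat (vcdim P (k_union k R))
            \<ge> ereal (1/112 * real d * real k * log 2 (real k)) \<and>
         ereal_of_enat (vcdim P (k_inter k R))
            \<ge> ereal (1/112) * ereal_of_enat (vcdim P R) * ereal (real k * log 2 (real k)) \<and>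
         ereal_of_enat (vcdim P (k_inter k R))
            \<ge> ereal (1/112 * real d * real k * log 2 (real k))"
      by (intro exI[of _ "euclid d"]) (simp only: Let_def insert_iff simp_thms subset_refl)
  qed simp
qed

end
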